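(* Let $\alpha\in(0,1)\cup(1,2)$, let $B^{\mathcal H}_\alpha$ be the Hadamard fractional Brownian motion and $B$ the standard Brownian motion from which it is constructed. Then for any $t\ge0$ the following inverse representation holds (almost surely): $$B(t)=\frac{\sqrt{\Gamma(\alpha)}}{\Gamma((\alpha+1)/2)\,\Gamma((3-\alpha)/2)}\int_0^t\Big(\log\frac ts\Big)^{(1-\alpha)/2}dB^{\mathcal H}_\alpha(s).$$
   Context: $\mathbb R^+=(0,\infty)$. For $\beta>0$ the right-sided Hadamard integral is $$({}_{\mathcal H}\mathcal I^\beta_-f)(t)=\frac1{\Gamma(\beta)}\int_t^\infty\Big(\log\frac zt\Big)^{\beta-1}\frac{f(z)}{z}\,dz,\qquad t>0,$$ and for $\beta\in(0,1)$ the right-sided Hadamard derivative is $({}_{\mathcal H}\mathcal D^\beta_-f)(t)=-t\frac{d}{dt}({}_{\mathcal H}\mathcal I^{1-\beta}_-f)(t)$ (understood for almost every $t>0$). With $K_\alpha=\Gamma((\alpha+1)/2)/\sqrt{\Gamma(\alpha)}$, set ${}_{\mathcal H}\mathcal M^\alpha_-=K_\alpha\,{}_{\mathcal H}\mathcal D^{(1-\alpha)/2}_-$ for $\alpha\in(0,1)$ and ${}_{\mathcal H}\mathcal M^\alpha_-=K_\alpha\,{}_{\mathcal H}\mathcal I^{(\alpha-1)/2}_-$ for $\alpha\in(1,2)$. Let $B=\{B(t)\}_{t\ge0}$ be a standard Brownian motion. The Hadamard fractional Brownian motion is $$B^{\mathcal H}_\alpha(t)=\int_{\mathbb R^+}({}_{\mathcal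 H}\mathcal M^\alpha_-1_{[0,t)})(s)\,dB(s)=\frac1{\sqrt{\Gamma(\alpha)}}\int_0^t\Big(\log\frac ts\Big)^{(\alpha-1)/2}dB(s),\qquad t\ge 0.$$ For $f\in L_{2,\alpha}(\mathbb R^+):=\{f:\ {}_{\mathcal H}\mathcal M^\alpha_-f\in L_2(\mathbb R^+)\}$, the Wiener integral with respect to $B^{\mathcal H}_\alpha$ is defined by $$\int_{\mathbb R^+}f(s)\,dB^{\mathcal H}_\alpha(s):=\int_{\mathbb R^+}({}_{\mathcal H}\mathcal M^\alpha_-f)(s)\,dB(s),$$ and $\int_0^tf\,dB^{\mathcal H}_\alpha:=\int_{\mathbb R^+}f1_{[0,t)}\,dB^{\mathcal H}_\alpha$. *)

theory Defs
  imports "HOL-Probability.Probability"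
begin

locale standard_brownian_motion = prob_space M
  for M :: "'w measure" and B :: "real \<Rightarrow> 'w \<Rightarrow> real" +
  assumes measurable_BM: "\<And>t. 0 \<le> t \<Longrightarrow> B t \<in> borel_measurable M"
    and start_BM: "AE \<omega> in M. B 0 \<omega> = 0"
    and indep_increments_BM: "\<And>(n::nat) (t::nat \<Rightarrow> real).
      0 \<le> t 0 \<Longrightarrow> (\<And>i. i < n \<Longrightarrow> t i \<le> t (Suc i)) \<Longrightarrow>
      indep_vars (\<lambda>_. borel) (\<lambda>i \<omega>. B (t (Suc i)) \<omega> - B (t i) \<omega>) {..<n}"
    and normal_increments_BM: "\<And>s t. 0 \<le> s \<Longrightarrow> s < t \<Longrightarrow>
      distributed M lborel (\<lambda>\<omega>. B t \<omega> - B s \<omega>) (normal_density 0 (sqrt (t - s)))"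
    and continuous_paths_BM: "AE \<omega> in M. continuous_on {0..} (\<lambda>t. B t \<omega>)"

(* The completed measure is used because a function obtained by differentiating almost everywhere
   is only Lebesgue measurable in general. *)
definition L2_pos :: "(real \<Rightarrow> real) set" where
  "L2_pos = {f. f \<in> borel_measurable (lebesgue_on {0<..}) \<and>
                integrable (lebesgue_on {0<..}) (\<lambda>s. (f s)\<^sup>2)}"

definition step_partition :: "nat \<Rightarrow> (nat \<Rightarrow> real) \<Rightarrow> bool" where
  "step_partition n t \<longleftrightarrow> 0 \<le> t 0 \<and> (\<forall>i<n. t i \<le> t (Suc i))"

definition step_fun :: "nat \<Rightarrow> (nat \<Rightarrow> real) \<Rightarrow> (nat \<Rightarrow> real) \<Rightarrow> real \<Rightarrow> real" where
  "step_fun n t c s = (\<Sum>i<n. c i * indicator {t i..<t (Suc i)} s)"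

definition step_integral ::
    "(real \<Rightarrow> 'w \<Rightarrow> real) \<Rightarrow> nat \<Rightarrow> (nat \<Rightarrow> real) \<Rightarrow> (nat \<Rightarrow> real) \<Rightarrow> 'w \<Rightarrow> real" where
  "step_integral B n t c \<omega> = (\<Sum>i<n. c i * (B (t (Suc i)) \<omega> - B (t i) \<omega>))"

(* X is a version of the Wiener integral of f over (0, infinity): the extension by L2 limits of
   the integral of step functions. *)
definition has_wiener_integral ::
    "'w measure \<Rightarrow> (real \<Rightarrow> 'w \<Rightarrow> real) \<Rightarrow> (real \<Rightarrow> real) \<Rightarrow> ('w \<Rightarrow> real) \<Rightarrow> bool" where
  "has_wiener_integral M B f X \<longleftrightarrow>
     f \<in> L2_pos \<and> X \<in> borel_measurable M \<and> integrable M (\<lambda>\<omega>. (X \<omega>)\<^sup>2) \<and>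
     (\<exists>n t c. (\<forall>k::nat. step_partition (n k) (t k)) \<and>
        (\<lambda>k. \<integral>\<^sup>+ s. ennreal ((step_fun (n k) (t k) (c k) s - f s)\<^sup>2) \<partial>lebesgue_on {0<..})
          \<longlonglongrightarrow> 0 \<and>
        (\<lambda>k. \<integral>\<^sup>+ \<omega>. ennreal ((step_integral B (n k) (t k) (c k) \<omega> - X \<omega>)\<^sup>2) \<partial>M)
          \<longlonglongrightarrow> 0)"

(* The integral is determined only up to M-null sets; one version is chosen. *)
definition wiener_integral ::
    "'w measure \<Rightarrow> (real \<Rightarrow> 'w \<Rightarrow> real) \<Rightarrow> (real \<Rightarrow> real) \<Rightarrow> 'w \<Rightarrow> real" where
  "wiener_integral M B f = (SOME X. has_wiener_integral M B f X)"

definition hadamard_kernel :: "real \<Rightarrow> (real \<Rightarrow> real) \<Rightarrow> real \<Rightarrow> real \<Rightarrow> real" where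
  "hadamard_kernel \<beta> f t z = (ln (z / t)) powr (\<beta> - 1) * (f z / z)"

(* Meaningful for t > 0 only, as are the operators below. *)
definition hadamard_integral :: "real \<Rightarrow> (real \<Rightarrow> real) \<Rightarrow> real \<Rightarrow> real" where
  "hadamard_integral \<beta> f t =
     1 / Gamma \<beta> * (LINT z:{t<..}|lebesgue. hadamard_kernel \<beta> f t z)"

definition hadamard_deriv :: "real \<Rightarrow> (real \<Rightarrow> real) \<Rightarrow> real \<Rightarrow> real" where
  "hadamard_deriv \<beta> f t = - t * deriv (hadamard_integral (1 - \<beta>) f) t"

(* The integral and the derivative are total functions in HOL, so that their existence almost
   everywhere has to be stated separately. *)
definition has_hadamard_integral_ae :: "real \<Rightarrow> (real \<Rightarrow> real) \<Rightarrow> bool" where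
  "has_hadamard_integral_ae \<beta> f \<longleftrightarrow>
     (AE t in lebesgue_on {0<..}. set_integrable lebesgue {t<..} (hadamard_kernel \<beta> f t))"

definition has_hadamard_deriv_ae :: "real \<Rightarrow> (real \<Rightarrow> real) \<Rightarrow> bool" where
  "has_hadamard_deriv_ae \<beta> f \<longleftrightarrow>
     has_hadamard_integral_ae (1 - \<beta>) f \<and>
     (AE t in lebesgue_on {0<..}. hadamard_integral (1 - \<beta>) f differentiable (at t))"

definition hadamard_K :: "real \<Rightarrow> real" where
  "hadamard_K \<alpha> = Gamma ((\<alpha> + 1) / 2) / sqrt (Gamma \<alpha>)"

(* Intended for 0 < \<alpha> < 1 and 1 < \<alpha> < 2. *)
definition hadamard_M :: "real \<Rightarrow> (real \<Rightarrow> real) \<Rightarrow> real \<Rightarrow> real" where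
  "hadamard_M \<alpha> f t =
     hadamard_K \<alpha> * (if \<alpha> < 1 then hadamard_deriv ((1 - \<alpha>) / 2) f t
                     else hadamard_integral ((\<alpha> - 1) / 2) f t)"

definition L2_hadamard :: "real \<Rightarrow> (real \<Rightarrow> real) set" where
  "L2_hadamard \<alpha> =
     {f. (if \<alpha> < 1 then has_hadamard_deriv_ae ((1 - \<alpha>) / 2) f
          else has_hadamard_integral_ae ((\<alpha> - 1) / 2) f) \<and>
         hadamard_M \<alpha> f \<in> L2_pos}"

definition hadamard_fbm ::
    "'w measure \<Rightarrow> (real \<Rightarrow> 'w \<Rightarrow> real) \<Rightarrow> real \<Rightarrow> real \<Rightarrow> 'w \<Rightarrow> real" where
  "hadamard_fbm M B \<alpha> t = wiener_integral M B (hadamard_M \<alpha> (indicator {0..<t}))"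

(* The integral with respect to hadamard_fbm M B \<alpha>, for integrands in L2_hadamard \<alpha>; it is
   defined through the Brownian motion B that drives the process. *)
definition hadamard_fbm_integral ::
    "'w measure \<Rightarrow> (real \<Rightarrow> 'w \<Rightarrow> real) \<Rightarrow> real \<Rightarrow> (real \<Rightarrow> real) \<Rightarrow> 'w \<Rightarrow> real" where
  "hadamard_fbm_integral M B \<alpha> f = wiener_integral M B (hadamard_M \<alpha> f)"

definition hadamard_fbm_integral_upto ::
    "'w measure \<Rightarrow> (real \<Rightarrow> 'w \<Rightarrow> real) \<Rightarrow> real \<Rightarrow> real \<Rightarrow> (real \<Rightarrow> real) \<Rightarrow> 'w \<Rightarrow> real" where
  "hadamard_fbm_integral_upto M B \<alpha> t f =
     hadamard_fbm_integral M B \<alpha> (\<lambda>s. f s * indicator {0..<t} s)"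

lemma hadamard_fbm_integral_upto_1:
  "hadamard_fbm_integral_upto M B \<alpha> t (\<lambda>_. 1) = hadamard_fbm M B \<alpha> t"
  by (simp add: hadamard_fbm_integral_upto_def hadamard_fbm_integral_def hadamard_fbm_def)

end

theory Submission
  imports Defs
begin

text \<open>
  With \<open>f s = ln (t / s) powr ((1 - \<alpha>) / 2)\<close> on \<open>[0, t)\<close> and zero elsewhere, the operator
  \<open>hadamard_M \<alpha>\<close> maps \<open>f\<close> to a constant multiple of the indicator of \<open>[0, t)\<close>, except possibly
  at the point \<open>t\<close>. The reason is the semigroup property on powers of the logarithm: the
  substitution \<open>u = ln (z / r) / ln (t / r)\<close> turns the Hadamard integral of order \<open>a\<close> of
  \<open>ln (t / z) powr (b - 1)\<close> into a Beta integral, so that it equals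
  \<open>Gamma b / Gamma (a + b) * ln (t / r) powr (a + b - 1)\<close> (\<open>hadamard_integral_ln_powr\<close>).
  For \<open>\<alpha> > 1\<close> the exponents satisfy \<open>a + b = 1\<close>, and the power is constant. For \<open>\<alpha> < 1\<close> they
  satisfy \<open>a + b = 2\<close>, and the Hadamard derivative \<open>- r d/dr\<close> of \<open>ln (t / r)\<close> is constant. In
  both cases the constant is the inverse of the factor in the theorem (\<open>hadamard_M_ln_powr\<close>).

  The Wiener integral of \<open>c\<close> times the indicator of \<open>[0, t)\<close> ought to be \<open>c * (B t - B 0)\<close>, and
  \<open>B 0 = 0\<close> almost surely. Since the Wiener integral is a chosen version of an \<open>L\<^sup>2\<close> limit, this
  needs the uniqueness of that limit (\<open>has_wiener_integral_unique\<close>), which follows from the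
  isometry between step functions and their integrals. The isometry comes from
  \<open>E (B x - B y)\<^sup>2 = \<bar>x - y\<bar>\<close>: by polarization, this determines all inner products of increments
  of \<open>B\<close>, and the functions \<open>indicator {0..<x}\<close> satisfy the same identity in \<open>L\<^sup>2(0, \<infinity>)\<close>.
\<close>

section \<open>The Wiener integral\<close>

text \<open>
  The map \<open>x \<mapsto> Z x\<close> is a helix in \<open>L\<^sup>2\<close>. The notion is kept free of probability so that it applies
  both to Brownian motion and to the indicators of \<open>[0, x)\<close>.
\<close>
definition has_increment_isometry :: "'a measure \<Rightarrow> (real \<Rightarrow> 'a \<Rightarrow> real) \<Rightarrow> bool" where
  "has_increment_isometry N Z \<longleftrightarrow> (\<forall>x\<ge>0. \<forall>y\<ge>0.
     has_bochner_integral N (\<lambda>\<omega>. (Z x \<omega> - Z y \<omega>)\<^sup>2) \<bar>x - y\<bar>)"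

text \<open>
  For \<open>u \<le> v\<close> and \<open>u' \<le> v'\<close> this is the length of the intersection of \<open>[u, v)\<close> and \<open>[u', v')\<close>,
  in the form in which polarization produces it.
\<close>
definition overlap :: "real \<Rightarrow> real \<Rightarrow> real \<Rightarrow> real \<Rightarrow> real" where
  "overlap u v u' v' = (\<bar>v - u'\<bar> + \<bar>u - v'\<bar> - \<bar>v - v'\<bar> - \<bar>u - u'\<bar>) / 2"

text \<open>
  Polarization: \<open>2 (a - b) (c - d) = (a - d)\<^sup>2 + (b - c)\<^sup>2 - (a - c)\<^sup>2 - (b - d)\<^sup>2\<close> writes a product
  of increments through squares of increments, whose integrals are given. Integrability of the
  product comes with it.
\<close>
lemma has_bochner_integral_increment_mult:
  assumes "has_increment_isometry N Z" "0 \<le> u" "0 \<le> v" "0 \<le> u'" "0 \<le> v'"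
  shows "has_bochner_integral N (\<lambda>\<omega>. (Z v \<omega> - Z u \<omega>) * (Z v' \<omega> - Z u' \<omega>)) (overlap u v u' v')"
proof -
  have D: "has_bochner_integral N (\<lambda>\<omega>. (Z x \<omega> - Z y \<omega>)\<^sup>2) \<bar>x - y\<bar>" if "0 \<le> x" "0 \<le> y" for x y
    using assms(1) that by (auto simp: has_increment_isometry_def)
  have "has_bochner_integral N
      (\<lambda>\<omega>. ((Z v \<omega> - Z u' \<omega>)\<^sup>2 + (Z u \<omega> - Z v' \<omega>)\<^sup>2 - (Z v \<omega> - Z v' \<omega>)\<^sup>2 - (Z u \<omega> - Z u' \<omega>)\<^sup>2) / 2)
      (overlap u v u' v')"
    unfolding overlap_def using assms
    by (intro has_bochner_integral_divide_zero has_bochner_integral_diff has_bochner_integral_add D) auto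
  also have "(\<lambda>\<omega>. ((Z v \<omega> - Z u' \<omega>)\<^sup>2 + (Z u \<omega> - Z v' \<omega>)\<^sup>2 - (Z v \<omega> - Z v' \<omega>)\<^sup>2 - (Z u \<omega> - Z u' \<omega>)\<^sup>2) / 2)
      = (\<lambda>\<omega>. (Z v \<omega> - Z u \<omega>) * (Z v' \<omega> - Z u' \<omega>))"
    by (rule ext) (simp add: power2_eq_square field_simps)
  finally show ?thesis .
qed

text \<open>
  The right-hand side does not mention \<open>Z\<close> or \<open>N\<close>, so the same linear combination of increments has
  the same \<open>L\<^sup>2\<close> norm for all \<open>Z\<close> with isometric increments. Because the intervals may overlap, two
  partitions can be compared without a common refinement.
\<close>
lemma nn_integral_increment_sum:
  fixes a u v :: "'i \<Rightarrow> real"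
  assumes "has_increment_isometry N Z" "\<And>i. i \<in> I \<Longrightarrow> 0 \<le> u i \<and> 0 \<le> v i"
  shows "(\<integral>\<^sup>+ \<omega>. ennreal ((\<Sum>i\<in>I. a i * (Z (v i) \<omega> - Z (u i) \<omega>))\<^sup>2) \<partial>N)
    = ennreal (\<Sum>i\<in>I. \<Sum>j\<in>I. a i * a j * overlap (u i) (v i) (u j) (v j))"
proof -
  have "has_bochner_integral N
      (\<lambda>\<omega>. \<Sum>i\<in>I. \<Sum>j\<in>I. a i * a j * ((Z (v i) \<omega> - Z (u i) \<omega>) * (Z (v j) \<omega> - Z (u j) \<omega>)))
      (\<Sum>i\<in>I. \<Sum>j\<in>I. a i * a j * overlap (u i) (v i) (u j) (v j))"
    using assms
    by (intro has_bochner_integral_sum has_bochner_integral_mult_right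
        has_bochner_integral_increment_mult) auto
  also have "(\<lambda>\<omega>. \<Sum>i\<in>I. \<Sum>j\<in>I. a i * a j * ((Z (v i) \<omega> - Z (u i) \<omega>) * (Z (v j) \<omega> - Z (u j) \<omega>)))
     = (\<lambda>\<omega>. (\<Sum>i\<in>I. a i * (Z (v i) \<omega> - Z (u i) \<omega>))\<^sup>2)"
    by (rule ext) (simp add: power2_eq_square sum_product mult_ac)
  finally have I: "has_bochner_integral N (\<lambda>\<omega>. (\<Sum>i\<in>I. a i * (Z (v i) \<omega> - Z (u i) \<omega>))\<^sup>2)
      (\<Sum>i\<in>I. \<Sum>j\<in>I. a i * a j * overlap (u i) (v i) (u j) (v j))" .
  then show ?thesis
    by (subst nn_integral_eq_integral) (auto simp: has_bochner_integral_iff)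
qed

lemma has_increment_isometry_indicator:
  "has_increment_isometry (lebesgue_on {0<..}) (\<lambda>x. indicator {0..<x})"
  unfolding has_increment_isometry_def
proof (intro allI impI)
  fix x y :: real assume xy: "0 \<le> x" "0 \<le> y"
  let ?A = "{0<..} \<inter> {min x y..<max x y}"
  have "emeasure lebesgue ?A = ennreal \<bar>x - y\<bar>"
    \<comment> \<open>The half-line is open at 0, so an interval that starts at 0 loses that point.\<close>
  proof (cases "min x y = 0")
    case True
    then have "?A = {min x y<..<max x y}" by auto
    then show ?thesis by (simp add: max_def min_def)
  next
    case False
    then have "?A = {min x y..<max x y}" using xy by auto
    then show ?thesis by (simp add: max_def min_def)
  qed
  then have "emeasure lebesgue ?A < \<infinity>" "measure lebesgue ?A = \<bar>x - y\<bar>"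
    by (simp_all add: measure_def)
  then have "has_bochner_integral lebesgue (indicator ?A :: real \<Rightarrow> real) \<bar>x - y\<bar>"
    using has_bochner_integral_real_indicator[of ?A lebesgue] by simp
  also have "(indicator ?A :: real \<Rightarrow> real) =
      (\<lambda>s. indicator {0<..} s *\<^sub>R (indicator {0..<x} s - indicator {0..<y} s)\<^sup>2)"
    by (rule ext) (auto simp: indicator_def)
  finally show "has_bochner_integral (lebesgue_on {0<..})
      (\<lambda>s. (indicator {0..<x} s - indicator {0..<y} s)\<^sup>2) \<bar>x - y\<bar>"
    by (simp add: has_bochner_integral_iff integrable_restrict_space integral_restrict_space)
qed

lemma step_partition_nonneg:
  assumes "step_partition n t" "i \<le> n"
  shows "0 \<le> t i"
  using assms(2,1)
  by (induction i) (auto simp: step_partition_def Suc_le_eq intro: order_trans)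

context standard_brownian_motion
begin

lemma has_increment_isometry_BM: "has_increment_isometry M B"
proof -
  have less: "has_bochner_integral M (\<lambda>\<omega>. (B y \<omega> - B x \<omega>)\<^sup>2) (y - x)" if "0 \<le> x" "x < y" for x y
  proof -
    let ?d = "normal_density 0 (sqrt (y - x))"
    have D: "distributed M lborel (\<lambda>\<omega>. B y \<omega> - B x \<omega>) ?d"
      using normal_increments_BM that by simp
    have "has_bochner_integral lborel (\<lambda>z. ?d z * z\<^sup>2) (y - x)"
      using normal_moment_even[of "sqrt (y - x)" 0 1] that by (simp add: diff_divide_distrib)
    then show ?thesis
      using distributed_integrable[OF D, of "\<lambda>z. z\<^sup>2"] distributed_integral[OF D, of "\<lambda>z. z\<^sup>2"]
      by (simp add: has_bochner_integral_iff)
  qed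
  have "has_bochner_integral M (\<lambda>\<omega>. (B x \<omega> - B y \<omega>)\<^sup>2) \<bar>x - y\<bar>" if "0 \<le> x" "0 \<le> y" for x y
    using less[of x y] less[of y x] that
    by (cases x y rule: linorder_cases) (auto simp: power2_commute abs_if)
  then show ?thesis by (simp add: has_increment_isometry_def)
qed

text \<open>
  The Wiener isometry, for a difference of step functions over two unrelated partitions: the
  disjoint sum of the two index sets makes it a single combination of increments.
\<close>
lemma step_integral_diff_isometry:
  assumes "step_partition n t" "step_partition n' t'"
  shows "(\<integral>\<^sup>+ \<omega>. ennreal ((step_integral B n t c \<omega> - step_integral B n' t' c' \<omega>)\<^sup>2) \<partial>M)
    = (\<integral>\<^sup>+ s. ennreal ((step_fun n t c s - step_fun n' t' c' s)\<^sup>2) \<partial>lebesgue_on {0<..})"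
proof -
  let ?I = "{..<n} <+> {..<n'}"
  let ?u = "case_sum t t'" and ?v = "case_sum (\<lambda>i. t (Suc i)) (\<lambda>i. t' (Suc i))"
  let ?a = "case_sum c (\<lambda>i. - c' i)"
  have "0 \<le> ?u i \<and> 0 \<le> ?v i" if "i \<in> ?I" for i
    using that step_partition_nonneg[OF assms(1)] step_partition_nonneg[OF assms(2)] by auto
  note eq = nn_integral_increment_sum[of _ _ ?I ?u ?v ?a, OF _ this]
  have "(\<Sum>i\<in>?I. ?a i * (B (?v i) \<omega> - B (?u i) \<omega>)) =
      step_integral B n t c \<omega> - step_integral B n' t' c' \<omega>" for \<omega>
    by (simp add: sum.Plus step_integral_def sum_negf)
  moreover have ind: "indicator {0..<T (Suc i)} s - indicator {0..<T i} s =
      (indicator {T i..<T (Suc i)} s :: real)" if "step_partition k T" "i < k" for T k i s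
  proof -
    have "0 \<le> T i" "T i \<le> T (Suc i)"
      using step_partition_nonneg[OF that(1), of i] that by (auto simp: step_partition_def)
    then show ?thesis by (auto simp: indicator_def)
  qed
  have "(\<Sum>i\<in>?I. ?a i * (indicator {0..<?v i} s - indicator {0..<?u i} s)) =
      step_fun n t c s - step_fun n' t' c' s" for s
    by (simp add: sum.Plus step_fun_def sum_negf ind[OF assms(1)] ind[OF assms(2)])
  ultimately show ?thesis
    using eq[OF has_increment_isometry_BM] eq[OF has_increment_isometry_indicator] by simp
qed

end

lemma nn_integral_square_triangle:
  assumes "f \<in> borel_measurable N" "g \<in> borel_measurable N" "h \<in> borel_measurable N"
  shows "(\<integral>\<^sup>+ x. ennreal ((f x - h x)\<^sup>2) \<partial>N) \<le>
    2 * (\<integral>\<^sup>+ x. ennreal ((f x - g x)\<^sup>2) \<partial>N) + 2 * (\<integral>\<^sup>+ x. ennreal ((g x - h x)\<^sup>2) \<partial>N)"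
proof -
  have *: "(a - c)\<^sup>2 \<le> 2 * (a - b)\<^sup>2 + 2 * (b - c)\<^sup>2" for a b c :: real
    using zero_le_power2[of "(a - b) - (b - c)"] by (simp add: power2_eq_square field_simps)
  have "(\<integral>\<^sup>+ x. ennreal ((f x - h x)\<^sup>2) \<partial>N) \<le>
      (\<integral>\<^sup>+ x. 2 * ennreal ((f x - g x)\<^sup>2) + 2 * ennreal ((g x - h x)\<^sup>2) \<partial>N)"
  proof (rule nn_integral_mono)
    fix x
    have "ennreal ((f x - h x)\<^sup>2) \<le> ennreal (2 * (f x - g x)\<^sup>2 + 2 * (g x - h x)\<^sup>2)"
      by (intro ennreal_leI *)
    then show "ennreal ((f x - h x)\<^sup>2) \<le> 2 * ennreal ((f x - g x)\<^sup>2) + 2 * ennreal ((g x - h x)\<^sup>2)"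
      by (simp add: ennreal_plus ennreal_mult)
  qed
  then show ?thesis
    using assms by (simp add: nn_integral_add nn_integral_cmult)
qed

lemma step_fun_measurable [measurable]: "step_fun n t c \<in> borel_measurable (lebesgue_on {0<..})"
  unfolding step_fun_def
  by (intro borel_measurable_sum borel_measurable_times measurable_restrict_space1
      borel_measurable_indicator) auto

lemma (in standard_brownian_motion) step_integral_measurable:
  "step_partition n t \<Longrightarrow> step_integral B n t c \<in> borel_measurable M"
  unfolding step_integral_def
  by (intro borel_measurable_sum borel_measurable_times borel_measurable_diff measurable_BM
      step_partition_nonneg[of n t]) auto

text \<open>
  If step functions \<open>S k\<close> and \<open>S' k\<close> both approximate \<open>f\<close>, then \<open>S k - S' k\<close> tends to 0 in \<open>L\<^sup>2\<close>, and
  by the isometry so does the difference of their integrals.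
\<close>
lemma (in standard_brownian_motion) has_wiener_integral_unique:
  assumes "has_wiener_integral M B f X" "has_wiener_integral M B f Y"
  shows "AE \<omega> in M. X \<omega> = Y \<omega>"
proof -
  let ?L = "lebesgue_on {0<..} :: real measure"
  have f: "f \<in> borel_measurable ?L"
    and X: "X \<in> borel_measurable M" and Y: "Y \<in> borel_measurable M"
    using assms by (auto simp: has_wiener_integral_def L2_pos_def)
  obtain n t c where
    p: "\<And>k. step_partition (n k) (t k)"
    and sf: "(\<lambda>k. \<integral>\<^sup>+ s. ennreal ((step_fun (n k) (t k) (c k) s - f s)\<^sup>2) \<partial>?L) \<longlonglongrightarrow> 0"
    and sX: "(\<lambda>k. \<integral>\<^sup>+ \<omega>. ennreal ((step_integral B (n k) (t k) (c k) \<omega> - X \<omega>)\<^sup>2) \<partial>M) \<longlonglongrightarrow> 0"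
    using assms(1) unfolding has_wiener_integral_def by blast
  obtain n' t' c' where
    p': "\<And>k. step_partition (n' k) (t' k)"
    and sf': "(\<lambda>k. \<integral>\<^sup>+ s. ennreal ((step_fun (n' k) (t' k) (c' k) s - f s)\<^sup>2) \<partial>?L) \<longlonglongrightarrow> 0"
    and sY: "(\<lambda>k. \<integral>\<^sup>+ \<omega>. ennreal ((step_integral B (n' k) (t' k) (c' k) \<omega> - Y \<omega>)\<^sup>2) \<partial>M) \<longlonglongrightarrow> 0"
    using assms(2) unfolding has_wiener_integral_def by blast
  define S S' where "S k = step_fun (n k) (t k) (c k)" and "S' k = step_fun (n' k) (t' k) (c' k)" for k
  define J J' where "J k = step_integral B (n k) (t k) (c k)"
    and "J' k = step_integral B (n' k) (t' k) (c' k)" for k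
  have JM: "J k \<in> borel_measurable M" "J' k \<in> borel_measurable M" for k
    unfolding J_def J'_def by (auto intro: step_integral_measurable p p')
  have SM: "S k \<in> borel_measurable ?L" "S' k \<in> borel_measurable ?L" for k
    unfolding S_def S'_def by auto
  define a a' b b' where
    "a k = (\<integral>\<^sup>+ s. ennreal ((S k s - f s)\<^sup>2) \<partial>?L)" and "a' k = (\<integral>\<^sup>+ s. ennreal ((S' k s - f s)\<^sup>2) \<partial>?L)"
    and "b k = (\<integral>\<^sup>+ \<omega>. ennreal ((J k \<omega> - X \<omega>)\<^sup>2) \<partial>M)"
    and "b' k = (\<integral>\<^sup>+ \<omega>. ennreal ((J' k \<omega> - Y \<omega>)\<^sup>2) \<partial>M)" for k
  have lim: "a \<longlonglongrightarrow> 0" "a' \<longlonglongrightarrow> 0" "b \<longlonglongrightarrow> 0" "b' \<longlonglongrightarrow> 0"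
    using sf sf' sX sY unfolding a_def a'_def b_def b'_def S_def S'_def J_def J'_def by auto
  have bound: "(\<integral>\<^sup>+ \<omega>. ennreal ((X \<omega> - Y \<omega>)\<^sup>2) \<partial>M) \<le>
      2 * b k + 2 * (2 * (2 * a k + 2 * a' k) + 2 * b' k)" for k
  proof -
    have "(\<integral>\<^sup>+ \<omega>. ennreal ((X \<omega> - Y \<omega>)\<^sup>2) \<partial>M) \<le>
        2 * b k + 2 * (\<integral>\<^sup>+ \<omega>. ennreal ((J k \<omega> - Y \<omega>)\<^sup>2) \<partial>M)"
      using nn_integral_square_triangle[OF X JM(1) Y] by (simp add: b_def power2_commute)
    also have "(\<integral>\<^sup>+ \<omega>. ennreal ((J k \<omega> - Y \<omega>)\<^sup>2) \<partial>M) \<le>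
        2 * (\<integral>\<^sup>+ \<omega>. ennreal ((J k \<omega> - J' k \<omega>)\<^sup>2) \<partial>M) + 2 * b' k"
      using nn_integral_square_triangle[OF JM(1) JM(2) Y] by (simp add: b'_def)
    also have "(\<integral>\<^sup>+ \<omega>. ennreal ((J k \<omega> - J' k \<omega>)\<^sup>2) \<partial>M) = (\<integral>\<^sup>+ s. ennreal ((S k s - S' k s)\<^sup>2) \<partial>?L)"
      unfolding J_def J'_def S_def S'_def by (rule step_integral_diff_isometry[OF p p'])
    also have "\<dots> \<le> 2 * a k + 2 * a' k"
      using nn_integral_square_triangle[OF SM(1) f SM(2)] by (simp add: a_def a'_def power2_commute)
    finally show ?thesis by (simp add: mult_left_mono add_mono)
  qed
  have "(\<lambda>k. 2 * b k + 2 * (2 * (2 * a k + 2 * a' k) + 2 * b' k)) \<longlonglongrightarrow>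
      2 * 0 + 2 * (2 * (2 * 0 + 2 * 0) + 2 * 0)"
    by (intro tendsto_add ennreal_tendsto_cmult lim) auto
  then have "(\<lambda>k. 2 * b k + 2 * (2 * (2 * a k + 2 * a' k) + 2 * b' k)) \<longlonglongrightarrow> 0" by simp
  then have "(\<integral>\<^sup>+ \<omega>. ennreal ((X \<omega> - Y \<omega>)\<^sup>2) \<partial>M) \<le> 0"
    by (rule LIMSEQ_le_const) (use bound in blast)
  then show ?thesis
    using X Y by (simp add: nn_integral_0_iff_AE)
qed

lemma has_wiener_integral_AE_cong:
  assumes "has_wiener_integral M B f X" "g \<in> L2_pos" "AE s in lebesgue_on {0<..}. f s = g s"
  shows "has_wiener_integral M B g X"
proof -
  have "(\<integral>\<^sup>+ s. ennreal ((step_fun n t c s - f s)\<^sup>2) \<partial>lebesgue_on {0<..}) =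
      (\<integral>\<^sup>+ s. ennreal ((step_fun n t c s - g s)\<^sup>2) \<partial>lebesgue_on {0<..})" for n t c
    using assms(3) by (intro nn_integral_cong_AE) auto
  then show ?thesis
    using assms(1,2) by (simp add: has_wiener_integral_def)
qed

lemma (in standard_brownian_motion) wiener_integral_eq_AE:
  assumes "has_wiener_integral M B f X"
  shows "AE \<omega> in M. wiener_integral M B f \<omega> = X \<omega>"
proof -
  have "has_wiener_integral M B f (wiener_integral M B f)"
    unfolding wiener_integral_def
    using assms by (rule someI[of "has_wiener_integral M B f"])
  then show ?thesis using assms by (rule has_wiener_integral_unique)
qed

lemma indicator_in_L2_pos: "(\<lambda>s. c * indicator {0..<t} s) \<in> L2_pos"
proof -
  have "integrable lebesgue (\<lambda>s. c\<^sup>2 * indicator ({0<..} \<inter> {0..<t}) s)"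
  proof (intro integrable_mult_right integrable_real_indicator)
    have "emeasure lebesgue ({0<..} \<inter> {0..<t}) \<le> emeasure lebesgue {0..t}"
      by (intro emeasure_mono) auto
    also have "\<dots> < \<infinity>" by (simp add: emeasure_lborel_Icc_eq)
    finally show "emeasure lebesgue ({0<..} \<inter> {0..<t}) < \<infinity>" .
  qed auto
  also have "(\<lambda>s. c\<^sup>2 * indicator ({0<..} \<inter> {0..<t}) s) =
      (\<lambda>s. indicator {0<..} s *\<^sub>R (c * indicator {0..<t} s)\<^sup>2)"
    by (rule ext) (auto simp: indicator_def)
  finally show ?thesis
    by (auto simp: L2_pos_def integrable_restrict_space
        intro!: measurable_restrict_space1 borel_measurable_times borel_measurable_indicator)
qed

lemma (in standard_brownian_motion) has_wiener_integral_indicator: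
  assumes "0 \<le> t"
  shows "has_wiener_integral M B (\<lambda>s. c * indicator {0..<t} s) (\<lambda>\<omega>. c * (B t \<omega> - B 0 \<omega>))"
proof -
  \<comment> \<open>The integrand is itself a step function, so a constant sequence approximates it.\<close>
  let ?T = "\<lambda>i. if i = 0 then 0 else t"
  have sp: "step_partition 1 ?T" using assms by (auto simp: step_partition_def)
  have "integrable M (\<lambda>\<omega>. (B t \<omega> - B 0 \<omega>)\<^sup>2)"
    using has_increment_isometry_BM assms by (auto simp: has_increment_isometry_def has_bochner_integral_iff)
  then have "integrable M (\<lambda>\<omega>. (c * (B t \<omega> - B 0 \<omega>))\<^sup>2)"
    by (simp add: power_mult_distrib)
  moreover have "step_fun 1 ?T (\<lambda>_. c) s = c * indicator {0..<t} s"
    and "step_integral B 1 ?T (\<lambda>_. c) \<omega> = c * (B t \<omega> - B 0 \<omega>)" for s \<omega>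
    by (simp_all add: step_fun_def step_integral_def)
  ultimately show ?thesis
    unfolding has_wiener_integral_def
    using sp assms indicator_in_L2_pos measurable_BM
    by (intro conjI exI[of _ "\<lambda>_. 1"] exI[of _ "\<lambda>_. ?T"] exI[of _ "\<lambda>_ _. c"]) auto
qed

section \<open>Hadamard operators on powers of the logarithm\<close>

text \<open>
  The substitution \<open>g z = ln (z / r) / ln (t / r)\<close> maps \<open>(r, t)\<close> onto \<open>(0, 1)\<close>, with
  \<open>1 - g z = ln (t / z) / ln (t / r)\<close>, and carries the Euler Beta integrand to \<open>k\<close> up to a power of
  \<open>ln (t / r)\<close>.
\<close>
lemma hadamard_beta_integral:
  fixes a b r t :: real
  assumes "0 < a" "0 < b" "0 < r" "r < t"
  defines "k \<equiv> \<lambda>z. ln (z / r) powr (a - 1) * (ln (t / z) powr (b - 1) / z)"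
  shows "set_integrable lebesgue {r<..<t} k"
    and "(LINT z:{r<..<t}|lebesgue. k z) = Beta a b * ln (t / r) powr (a + b - 1)"
proof -
  define L where "L = ln (t / r)"
  define g where "g z = ln (z / r) / L" for z
  define h :: "real \<Rightarrow> real" where "h = (\<lambda>u. u powr (a - 1) * (1 - u) powr (b - 1))"
  have L: "L > 0" using assms by (simp add: L_def)
  have inj: "inj_on g {r<..<t}"
    using L assms by (auto simp: inj_on_def g_def ln_div)
  have image: "g ` {r<..<t} = {0<..<1}"
  proof (intro equalityI subsetI)
    fix u assume "u \<in> g ` {r<..<t}"
    then show "u \<in> {0<..<1}" using L assms by (auto simp: g_def L_def ln_div)
  next
    fix u :: real assume u: "u \<in> {0<..<1}"
    have "r * exp (u * L) < r * exp L" using u L assms by simp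
    also have "r * exp L = t" using assms by (simp add: L_def)
    finally have "r * exp (u * L) \<in> {r<..<t}" using u L assms by simp
    moreover have "u = g (r * exp (u * L))" using L assms by (simp add: g_def)
    ultimately show "u \<in> g ` {r<..<t}" by blast
  qed
  have der: "(g has_field_derivative 1 / (z * L)) (at z within {r<..<t})" if "z \<in> {r<..<t}" for z
    unfolding g_def using that assms L by (auto intro!: derivative_eq_intros simp: field_simps)
  have "(h has_integral Beta a b) {0<..<1}"
    using has_integral_Beta_real[OF assms(1,2)] by (simp add: h_def has_integral_Icc_iff_Ioo)
  moreover from this have "h absolutely_integrable_on {0<..<1}"
    by (intro nonnegative_absolutely_integrable_1) (auto simp: h_def)
  ultimately have *: "(\<lambda>z. \<bar>1 / (z * L)\<bar> * h (g z)) absolutely_integrable_on {r<..<t}"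
      "integral {r<..<t} (\<lambda>z. \<bar>1 / (z * L)\<bar> * h (g z)) = Beta a b"
    using has_absolute_integral_change_of_variables_1'[of "{r<..<t}" g "\<lambda>z. 1 / (z * L)" h "Beta a b",
        OF _ der inj]
    by (auto simp: image integral_unique)
  have k: "k z = L powr (a + b - 1) * (\<bar>1 / (z * L)\<bar> * h (g z))" if z: "z \<in> {r<..<t}" for z
  proof -
    have "1 - g z = ln (t / z) / L"
      using L z assms by (simp add: g_def L_def ln_div field_simps)
    moreover have "ln (z / r) > 0" "ln (t / z) > 0" using z assms by auto
    moreover have "L powr (a + b - 1) = L powr (a - 1) * L powr (b - 1) * L"
      using L by (simp add: powr_add powr_diff)
    ultimately show ?thesis
      using L z assms by (simp add: k_def h_def g_def powr_divide)
  qed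
  show k_int: "set_integrable lebesgue {r<..<t} k"
    using set_integrable_mult_right[of "L powr (a + b - 1)", OF *(1)]
    by (subst set_integrable_cong[OF refl refl k]) auto
  have "(LINT z:{r<..<t}|lebesgue. k z) =
      L powr (a + b - 1) * (LINT z:{r<..<t}|lebesgue. \<bar>1 / (z * L)\<bar> * h (g z))"
    by (subst set_integral_mult_right[symmetric], rule set_lebesgue_integral_cong) (auto simp: k)
  also have "\<dots> = L powr (a + b - 1) * Beta a b"
    using set_lebesgue_integral_eq_integral(2)[OF *(1)] *(2) by simp
  finally show "(LINT z:{r<..<t}|lebesgue. k z) = Beta a b * ln (t / r) powr (a + b - 1)"
    by (simp add: L_def)
qed

lemma hadamard_integral_ln_powr:
  fixes a b r t :: real
  assumes "0 < a" "0 < b" "0 < r"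
  defines "f \<equiv> \<lambda>s. ln (t / s) powr (b - 1) * indicator {0..<t} s"
  shows "set_integrable lebesgue {r<..} (hadamard_kernel a f r)"
    and "hadamard_integral a f r =
      (if r < t then Gamma b / Gamma (a + b) * ln (t / r) powr (a + b - 1) else 0)"
proof -
  let ?k = "\<lambda>z. ln (z / r) powr (a - 1) * (ln (t / z) powr (b - 1) / z)"
  have eq: "indicator {r<..} z *\<^sub>R hadamard_kernel a f r z = indicator {r<..<t} z *\<^sub>R ?k z" for z
    using assms(3) by (auto simp: hadamard_kernel_def f_def indicator_def)
  have "set_integrable lebesgue {r<..<t} ?k"
    using hadamard_beta_integral(1)[of a b r t] assms
    by (cases "r < t") (auto simp: set_integrable_def)
  then show "set_integrable lebesgue {r<..} (hadamard_kernel a f r)"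
    by (simp only: set_integrable_def eq)
  have "(LINT z:{r<..}|lebesgue. hadamard_kernel a f r z) = (LINT z:{r<..<t}|lebesgue. ?k z)"
    by (simp only: set_lebesgue_integral_def eq)
  also have "\<dots> = (if r < t then Beta a b * ln (t / r) powr (a + b - 1) else 0)"
    using hadamard_beta_integral(2)[of a b r t] assms by (auto simp: set_lebesgue_integral_def)
  finally show "hadamard_integral a f r =
      (if r < t then Gamma b / Gamma (a + b) * ln (t / r) powr (a + b - 1) else 0)"
    using Gamma_real_pos[OF assms(1)] by (auto simp: hadamard_integral_def Beta_def)
qed

text \<open>
  The Hadamard integral of order \<open>1 - \<beta>\<close> raises the exponent \<open>\<beta>\<close> to 1. The resulting function
  \<open>Gamma (1 + \<beta>) * ln (t / r)\<close>, continued by zero, has a corner at \<open>r = t\<close>, which is therefore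
  excluded.
\<close>
lemma hadamard_deriv_ln_powr:
  fixes \<beta> r t :: real
  assumes "0 < \<beta>" "\<beta> < 1" "0 < r" "r \<noteq> t"
  defines "f \<equiv> \<lambda>s. ln (t / s) powr \<beta> * indicator {0..<t} s"
  shows "hadamard_integral (1 - \<beta>) f differentiable (at r)"
    and "hadamard_deriv \<beta> f r = Gamma (1 + \<beta>) * indicator {0..<t} r"
proof -
  have I: "hadamard_integral (1 - \<beta>) f x = (if x < t then Gamma (1 + \<beta>) * (ln t - ln x) else 0)"
    if "0 < x" for x
    using hadamard_integral_ln_powr(2)[of "1 - \<beta>" "1 + \<beta>" x t] assms(1-3) that
    by (auto simp: f_def ln_div Gamma_numeral)
  have D: "(hadamard_integral (1 - \<beta>) f has_field_derivative
      - (Gamma (1 + \<beta>) * indicator {0..<t} r) / r) (at r)"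
  proof (cases "r < t")
    case True
    have "((\<lambda>x. Gamma (1 + \<beta>) * (ln t - ln x)) has_field_derivative - Gamma (1 + \<beta>) / r) (at r)"
      using assms by (auto intro!: derivative_eq_intros simp: field_simps)
    then show ?thesis
      using True assms(3)
      by (subst DERIV_cong_ev[OF refl _ refl, where g = "\<lambda>x. Gamma (1 + \<beta>) * (ln t - ln x)"])
        (auto simp: I intro!: eventually_nhds_in_open[THEN eventually_mono, of "{0<..<t}"])
  next
    case False
    then show ?thesis
      using assms(3,4)
      by (subst DERIV_cong_ev[OF refl _ refl, where g = "\<lambda>x. 0"])
        (auto simp: I intro!: eventually_nhds_in_open[THEN eventually_mono, of "{t<..} \<inter> {0<..}"])
  qed
  then show "hadamard_integral (1 - \<beta>) f differentiable (at r)"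
    unfolding real_differentiable_def by blast
  show "hadamard_deriv \<beta> f r = Gamma (1 + \<beta>) * indicator {0..<t} r"
    using DERIV_imp_deriv[OF D] assms(3) by (simp add: hadamard_deriv_def)
qed

lemma AE_lebesgue_on_neq: "AE r in lebesgue_on S. r \<noteq> (t :: real)" if "S \<in> sets lebesgue"
proof -
  have "AE r in lebesgue. r \<noteq> t"
    by (intro AE_I[where N = "{t}"]) auto
  then show ?thesis using that by (subst AE_restrict_space_iff) auto
qed

text \<open>
  For \<open>\<alpha> < 1\<close> the value of \<open>deriv\<close> at the corner \<open>r = t\<close> is unspecified, so membership in \<open>L\<^sup>2\<close> has to be
  insensitive to one point; measurability survives because points are measurable.
\<close>
lemma L2_pos_cong_off_point:
  assumes "\<And>r. 0 < r \<Longrightarrow> r \<noteq> t \<Longrightarrow> f r = g r" "g \<in> L2_pos"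
  shows "f \<in> L2_pos"
proof -
  let ?L = "lebesgue_on {0<..} :: real measure"
  have "{x \<in> space ?L. x = t} = (if 0 < t then {t} else {})" by auto
  then have "{x \<in> space ?L. x = t} \<in> sets ?L" by (auto simp: sets_restrict_space_iff)
  then have "(\<lambda>r. if r = t then f t else g r) \<in> borel_measurable ?L"
    using assms(2) by (intro measurable_If) (auto simp: L2_pos_def)
  then have f: "f \<in> borel_measurable ?L"
    using assms(1) by (subst measurable_cong[where g = "\<lambda>r. if r = t then f t else g r"]) auto
  have "AE r in ?L. f r = g r"
    using AE_lebesgue_on_neq[of "{0<..}" t] AE_space assms(1) by (auto elim: eventually_elim2)
  then have "integrable ?L (\<lambda>s. (f s)\<^sup>2) = integrable ?L (\<lambda>s. (g s)\<^sup>2)"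
    using f assms(2) by (intro integrable_cong_AE) (auto simp: L2_pos_def)
  then show ?thesis using f assms(2) by (simp add: L2_pos_def)
qed

text \<open>
  For \<open>\<alpha> < 1\<close> put \<open>\<beta> = (1 - \<alpha>) / 2\<close>, so that \<open>1 + \<beta> = (3 - \<alpha>) / 2\<close>. For \<open>\<alpha> > 1\<close> the order
  \<open>(\<alpha> - 1) / 2\<close> and \<open>b = (3 - \<alpha>) / 2\<close> add up to 1. This is where the two definitions of
  \<open>hadamard_M\<close> give the same answer.
\<close>
lemma hadamard_M_ln_powr:
  fixes \<alpha> r t :: real
  assumes "\<alpha> \<in> {0<..<1} \<union> {1<..<2}" "0 < r" "r \<noteq> t"
  shows "hadamard_M \<alpha> (\<lambda>s. ln (t / s) powr ((1 - \<alpha>) / 2) * indicator {0..<t} s) r =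
    hadamard_K \<alpha> * Gamma ((3 - \<alpha>) / 2) * indicator {0..<t} r"
proof (cases "\<alpha> < 1")
  case True
  have e: "1 + (1 - \<alpha>) / 2 = (3 - \<alpha>) / 2" by (simp add: field_simps)
  show ?thesis
    using True hadamard_deriv_ln_powr(2)[of "(1 - \<alpha>) / 2" r t, unfolded e] assms by (simp add: hadamard_M_def)
next
  case False
  have e: "(3 - \<alpha>) / 2 - 1 = (1 - \<alpha>) / 2" "(\<alpha> - 1) / 2 + (3 - \<alpha>) / 2 = 1" by (auto simp: field_simps)
  show ?thesis
    using False hadamard_integral_ln_powr(2)[of "(\<alpha> - 1) / 2" "(3 - \<alpha>) / 2" r t, unfolded e] assms
    by (auto simp: hadamard_M_def)
qed

lemma ln_powr_in_L2_hadamard: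
  fixes \<alpha> t :: real
  assumes "\<alpha> \<in> {0<..<1} \<union> {1<..<2}"
  shows "(\<lambda>s. ln (t / s) powr ((1 - \<alpha>) / 2) * indicator {0..<t} s) \<in> L2_hadamard \<alpha>"
proof -
  let ?f = "\<lambda>s. ln (t / s) powr ((1 - \<alpha>) / 2) * indicator {0..<t} s"
  let ?L = "lebesgue_on {0<..} :: real measure"
  have e: "(3 - \<alpha>) / 2 - 1 = (1 - \<alpha>) / 2" by (simp add: field_simps)
  have ae: "AE r in ?L. P r" if "\<And>r. 0 < r \<Longrightarrow> r \<noteq> t \<Longrightarrow> P r" for P
    using AE_lebesgue_on_neq[of "{0<..}" t] AE_space that by (auto elim: eventually_elim2)
  have int: "has_hadamard_integral_ae a ?f" if "0 < a" for a
    unfolding has_hadamard_integral_ae_def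
    using hadamard_integral_ln_powr(1)[of a "(3 - \<alpha>) / 2" _ t, unfolded e] that assms
    by (intro ae) auto
  have "has_hadamard_deriv_ae ((1 - \<alpha>) / 2) ?f" if "\<alpha> < 1"
    unfolding has_hadamard_deriv_ae_def
  proof
    show "has_hadamard_integral_ae (1 - (1 - \<alpha>) / 2) ?f"
      using that assms by (intro int) auto
    show "AE r in ?L. hadamard_integral (1 - (1 - \<alpha>) / 2) ?f differentiable (at r)"
      using that assms by (intro ae hadamard_deriv_ln_powr(1)) auto
  qed
  moreover have "has_hadamard_integral_ae ((\<alpha> - 1) / 2) ?f" if "\<not> \<alpha> < 1"
    using that assms by (intro int) auto
  moreover have "hadamard_M \<alpha> ?f \<in> L2_pos"
    by (rule L2_pos_cong_off_point[OF hadamard_M_ln_powr[OF assms] indicator_in_L2_pos])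
  ultimately show ?thesis by (simp add: L2_hadamard_def)
qed

section \<open>The inverse representation of Brownian motion\<close>

theorem corollary7p1:
  fixes M :: "'w measure" and B :: "real \<Rightarrow> 'w \<Rightarrow> real" and \<alpha> t :: real
  assumes "standard_brownian_motion M B"
    and "\<alpha> \<in> {0<..<1} \<union> {1<..<2}"
    and "0 \<le> t"
  shows "(\<lambda>s. (ln (t / s)) powr ((1 - \<alpha>) / 2) * indicator {0..<t} s) \<in> L2_hadamard \<alpha> \<and>
    (AE \<omega> in M. B t \<omega> =
       sqrt (Gamma \<alpha>) / (Gamma ((\<alpha> + 1) / 2) * Gamma ((3 - \<alpha>) / 2)) *
       hadamard_fbm_integral_upto M B \<alpha> t (\<lambda>s. (ln (t / s)) powr ((1 - \<alpha>) / 2)) \<omega>)"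
proof
  interpret standard_brownian_motion M B by fact
  let ?f = "\<lambda>s. ln (t / s) powr ((1 - \<alpha>) / 2) * indicator {0..<t} s"
  let ?c = "hadamard_K \<alpha> * Gamma ((3 - \<alpha>) / 2)"
  show L2: "?f \<in> L2_hadamard \<alpha>"
    by (rule ln_powr_in_L2_hadamard[OF assms(2)])
  have "AE r in lebesgue_on {0<..}. ?c * indicator {0..<t} r = hadamard_M \<alpha> ?f r"
    using AE_lebesgue_on_neq[of "{0<..}" t] AE_space hadamard_M_ln_powr[OF assms(2)]
    by (auto elim: eventually_elim2)
  then have "has_wiener_integral M B (hadamard_M \<alpha> ?f) (\<lambda>\<omega>. ?c * (B t \<omega> - B 0 \<omega>))"
    using L2 by (intro has_wiener_integral_AE_cong[OF has_wiener_integral_indicator[OF assms(3)]])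
      (auto simp: L2_hadamard_def)
  from wiener_integral_eq_AE[OF this]
  have I: "AE \<omega> in M. hadamard_fbm_integral_upto M B \<alpha> t (\<lambda>s. ln (t / s) powr ((1 - \<alpha>) / 2)) \<omega> =
      ?c * (B t \<omega> - B 0 \<omega>)"
    by (simp add: hadamard_fbm_integral_upto_def hadamard_fbm_integral_def)
  have pos: "Gamma \<alpha> > 0" "Gamma ((\<alpha> + 1) / 2) > 0" "Gamma ((3 - \<alpha>) / 2) > 0"
    using assms(2) by (auto intro!: Gamma_real_pos)
  show "AE \<omega> in M. B t \<omega> =
       sqrt (Gamma \<alpha>) / (Gamma ((\<alpha> + 1) / 2) * Gamma ((3 - \<alpha>) / 2)) *
       hadamard_fbm_integral_upto M B \<alpha> t (\<lambda>s. (ln (t / s)) powr ((1 - \<alpha>) / 2)) \<omega>"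
    using I start_BM by eventually_elim (use pos in \<open>simp add: hadamard_K_def\<close>)
qed

end
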